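(* Let $E=(e_X,e_Y,R)$ be an extension polarity extending the poset $P$. The following are equivalent: (1) $E$ is 3-coherent; (2) $\preceq_3$ is a 3-preorder for $E$; (3) there exists a 3-preorder for $E$. Moreover, the set of 3-preorders for $E$ is closed under non-empty intersections and, if it is non-empty, has $\preceq_3$ as its smallest member.
   Context: An extension polarity is a triple $(e_X,e_Y,R)$ where $P$ is a poset, $X,Y$ are disjoint posets, $e_X:P\to X$ and $e_Y:P\to Y$ are order embeddings, and $R\subseteq X\times Y$. Coherence conditions: (C1) if $x_1\le_X x_2$ and $x_2\mathrel{R}y$ then $x_1\mathrel{R}y$. (C2) if $y_1\le_Y y_2$ and $x\mathrel{R}y_1$ then $x\mathrel{R}y_2$. (C3) $e_X(p)\mathrel{R}e_Y(p)$ for all $p\in P$. (C4) if $x\mathrel{R}e_Y(p)$ and $e_X(p)\mathrel{R}y$ then $x\mathrel{R}y$. (C5) if $x_1\mathrel{R}e_Y(p)$ and $e_X(p)\le_X x_2$ then $x_1\le_X x_2$. (C6) if $y_1\le_Y e_Y(p)$ and $e_X(p)\mathrel{R}y_2$ then $y_1\le_Y y_2$. (C7) for all $x\in X$, $y_1,y_2\in Y$, $S\subseteq P$: if $\bigwedge e_X[S]=x$ in $X$, $x\mathrel{R}y_2$, and $y_1\le_Y e_Y(p)$ for all $p\in S$, then $y_1\le_Y y_2$. (C8) for all $x_1,x_2\in X$, $y\in Y$, $T\subseteq P$: if $\bigvee e_Y[T]=y$ in $Y$, $x_1\mathrel{R}y$, and $e_X(q)\le_X x_2$ for all $q\in T$,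 then $x_1\le_X x_2$. (All variables range over $X$, $Y$, $P$ as appropriate.) $E$ is 3-coherent if it satisfies (C1)–(C8). For a preorder $\preceq$ on $X\cup Y$, $X\uplus_\preceq Y$ is the quotient poset (identify $z_1,z_2$ when $z_1\preceq z_2\preceq z_1$) and $\iota_X,\iota_Y$ are the inclusions composed with the quotient map. A 0-preorder for $E$ is a preorder $\preceq$ on $X\cup Y$ with: $x\preceq y\iff x\mathrel{R}y$ for $x\in X,y\in Y$; ${\le_X}\subseteq{\preceq}$; ${\le_Y}\subseteq{\preceq}$. A 1-preorder is a 0-preorder with $\iota_X\circ e_X=\iota_Y\circ e_Y$. A 2-preorder is a 1-preorder with $\iota_X,\iota_Y$ order embeddings. A 3-preorder is a 2-preorder such that (P4) for all $S\subseteq P$, if $\bigwedge e_X[S]$ exists in $X$ then $\iota_X(\bigwedge e_X[S])=\bigwedge\iota_X\circ e_X[S]$ in $X\uplus_\preceq Y$; and (P5) for all $T\subseteq P$, if $\bigvee e_Y[T]$ exists in $Y$ then $\iota_Y(\bigvee e_Y[T])=\bigvee \iota_Y\circ e_Y[T]$ in $X\uplus_\preceq Y$. $\preceq_3$ is the union of ${\le_X}\cup{\le_Y}\cup R$ with $Z_S=\{(y,x)\in Y\times X:\exists S\subseteq P\,(\bigwedge e_X[S]\text{ exists in }X,\ \bigwedge e_X[S]\le_X x,\ y\le_Y e_Y(p)\ \forall p\in S)\}$ and $Z_T=\{(y,x)\in Y\times X:\exists T\subseteq P\,(\bigvee e_Y[T]\text{ exists in }Y,\ y\le_Y\bigvee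 e_Y[T],\ e_X(q)\le_X x\ \forall q\in T)\}$. *)

theory Defs
  imports Main
begin

text \<open>
  A relation \<open>r :: 'a rel\<close> on a carrier is read as an order with
  \<open>(a, b) \<in> r\<close> meaning that \<open>a\<close> is below \<open>b\<close>.
  Posets are pairs \<open>A\<close>, \<open>r\<close> with \<^term>\<open>partial_order_on A r\<close>; carriers
  may be empty.
\<close>

definition is_inf :: "'a set \<Rightarrow> 'a rel \<Rightarrow> 'a set \<Rightarrow> 'a \<Rightarrow> bool" where
  "is_inf A r S m \<longleftrightarrow>
     m \<in> A \<and> (\<forall>s\<in>S. (m, s) \<in> r) \<and> (\<forall>z\<in>A. (\<forall>s\<in>S. (z, s) \<in> r) \<longrightarrow> (z, m) \<in> r)"

definition is_sup :: "'a set \<Rightarrow> 'a rel \<Rightarrow> 'a set \<Rightarrow> 'a \<Rightarrow> bool" where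
  "is_sup A r S m \<longleftrightarrow>
     m \<in> A \<and> (\<forall>s\<in>S. (s, m) \<in> r) \<and> (\<forall>z\<in>A. (\<forall>s\<in>S. (s, z) \<in> r) \<longrightarrow> (m, z) \<in> r)"

definition order_embedding ::
  "'a set \<Rightarrow> 'a rel \<Rightarrow> 'b set \<Rightarrow> 'b rel \<Rightarrow> ('a \<Rightarrow> 'b) \<Rightarrow> bool" where
  "order_embedding A r B s f \<longleftrightarrow>
     f ` A \<subseteq> B \<and> (\<forall>a\<in>A. \<forall>b\<in>A. (a, b) \<in> r \<longleftrightarrow> (f a, f b) \<in> s)"

text \<open>
  \<open>X\<close> and \<open>Y\<close> share one type, so that \<open>X \<union> Y\<close> can be formed literally;
  their disjointness is part of \<open>extension_polarity\<close> below.
\<close>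

record ('p, 'a) polarity =
  carP :: "'p set"
  leP :: "'p rel"
  carX :: "'a set"
  leX :: "'a rel"
  carY :: "'a set"
  leY :: "'a rel"
  eX :: "'p \<Rightarrow> 'a"
  eY :: "'p \<Rightarrow> 'a"
  relR :: "'a rel"

definition extension_polarity :: "('p, 'a) polarity \<Rightarrow> bool" where
  "extension_polarity E \<longleftrightarrow>
     partial_order_on (carP E) (leP E) \<and>
     partial_order_on (carX E) (leX E) \<and>
     partial_order_on (carY E) (leY E) \<and>
     carX E \<inter> carY E = {} \<and>
     order_embedding (carP E) (leP E) (carX E) (leX E) (eX E) \<and>
     order_embedding (carP E) (leP E) (carY E) (leY E) (eY E) \<and>
     relR E \<subseteq> carX E \<times> carY E"

definition C1 :: "('p, 'a) polarity \<Rightarrow> bool" where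
  "C1 E \<longleftrightarrow> (\<forall>x1\<in>carX E. \<forall>x2\<in>carX E. \<forall>y\<in>carY E.
     (x1, x2) \<in> leX E \<and> (x2, y) \<in> relR E \<longrightarrow> (x1, y) \<in> relR E)"

definition C2 :: "('p, 'a) polarity \<Rightarrow> bool" where
  "C2 E \<longleftrightarrow> (\<forall>x\<in>carX E. \<forall>y1\<in>carY E. \<forall>y2\<in>carY E.
     (y1, y2) \<in> leY E \<and> (x, y1) \<in> relR E \<longrightarrow> (x, y2) \<in> relR E)"

definition C3 :: "('p, 'a) polarity \<Rightarrow> bool" where
  "C3 E \<longleftrightarrow> (\<forall>p\<in>carP E. (eX E p, eY E p) \<in> relR E)"

definition C4 :: "('p, 'a) polarity \<Rightarrow> bool" where
  "C4 E \<longleftrightarrow> (\<forall>x\<in>carX E. \<forall>y\<in>carY E. \<forall>p\<in>carP E.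
     (x, eY E p) \<in> relR E \<and> (eX E p, y) \<in> relR E \<longrightarrow> (x, y) \<in> relR E)"

definition C5 :: "('p, 'a) polarity \<Rightarrow> bool" where
  "C5 E \<longleftrightarrow> (\<forall>x1\<in>carX E. \<forall>x2\<in>carX E. \<forall>p\<in>carP E.
     (x1, eY E p) \<in> relR E \<and> (eX E p, x2) \<in> leX E \<longrightarrow> (x1, x2) \<in> leX E)"

definition C6 :: "('p, 'a) polarity \<Rightarrow> bool" where
  "C6 E \<longleftrightarrow> (\<forall>y1\<in>carY E. \<forall>y2\<in>carY E. \<forall>p\<in>carP E.
     (y1, eY E p) \<in> leY E \<and> (eX E p, y2) \<in> relR E \<longrightarrow> (y1, y2) \<in> leY E)"

definition C7 :: "('p, 'a) polarity \<Rightarrow> bool" where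
  "C7 E \<longleftrightarrow> (\<forall>x\<in>carX E. \<forall>y1\<in>carY E. \<forall>y2\<in>carY E. \<forall>S\<subseteq>carP E.
     is_inf (carX E) (leX E) (eX E ` S) x \<and> (x, y2) \<in> relR E \<and> (\<forall>p\<in>S. (y1, eY E p) \<in> leY E)
     \<longrightarrow> (y1, y2) \<in> leY E)"

definition C8 :: "('p, 'a) polarity \<Rightarrow> bool" where
  "C8 E \<longleftrightarrow> (\<forall>x1\<in>carX E. \<forall>x2\<in>carX E. \<forall>y\<in>carY E. \<forall>T\<subseteq>carP E.
     is_sup (carY E) (leY E) (eY E ` T) y \<and> (x1, y) \<in> relR E \<and> (\<forall>q\<in>T. (eX E q, x2) \<in> leX E)
     \<longrightarrow> (x1, x2) \<in> leX E)"

definition three_coherent :: "('p, 'a) polarity \<Rightarrow> bool" where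
  "three_coherent E \<longleftrightarrow> C1 E \<and> C2 E \<and> C3 E \<and> C4 E \<and> C5 E \<and> C6 E \<and> C7 E \<and> C8 E"

definition sym_part :: "'a rel \<Rightarrow> 'a rel" where
  "sym_part r = r \<inter> r\<inverse>"

text \<open>
  The quotient poset of \<open>X \<union> Y\<close> by a preorder \<open>r\<close>. The maps \<open>\<iota>\<^sub>X\<close> and \<open>\<iota>\<^sub>Y\<close>
  are both given by \<open>\<iota> r\<close>, restricted to \<open>X\<close> and to \<open>Y\<close> respectively.
\<close>

definition \<iota> :: "'a rel \<Rightarrow> 'a \<Rightarrow> 'a set" where
  "\<iota> r z = sym_part r `` {z}"

definition quot_carrier :: "('p, 'a) polarity \<Rightarrow> 'a rel \<Rightarrow> 'a set set" where
  "quot_carrier E r = (carX E \<union> carY E) // sym_part r"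

definition quot_le :: "'a rel \<Rightarrow> 'a set rel" where
  "quot_le r = {(\<iota> r z1, \<iota> r z2) | z1 z2. (z1, z2) \<in> r}"

lemma partial_order_on_quot:
  assumes "preorder_on (carX E \<union> carY E) r"
  shows "partial_order_on (quot_carrier E r) (quot_le r)"
proof -
  have sub: "r \<subseteq> (carX E \<union> carY E) \<times> (carX E \<union> carY E)" and re: "refl_on (carX E \<union> carY E) r" and tr: "trans r"
    using assms by (auto simp: preorder_on_def)
  have iota_eq: "\<iota> r a = \<iota> r b \<longleftrightarrow> (a, b) \<in> r \<and> (b, a) \<in> r"
    if "a \<in> carX E \<union> carY E" "b \<in> carX E \<union> carY E" for a b
    using that re tr
    by (fastforce simp: \<iota>_def sym_part_def refl_on_def set_eq_iff dest: transD)
  have le: "(\<iota> r a, \<iota> r b) \<in> quot_le r \<longleftrightarrow> (a, b) \<in> r"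
    if "a \<in> carX E \<union> carY E" "b \<in> carX E \<union> carY E" for a b
  proof
    assume "(\<iota> r a, \<iota> r b) \<in> quot_le r"
    then obtain c d where cd: "(c, d) \<in> r" "\<iota> r a = \<iota> r c" "\<iota> r b = \<iota> r d"
      by (auto simp: quot_le_def)
    then have "c \<in> carX E \<union> carY E" "d \<in> carX E \<union> carY E" using sub by auto
    then show "(a, b) \<in> r" using cd iota_eq that tr by (meson transD)
  qed (auto simp: quot_le_def)
  have carrier: "quot_carrier E r = \<iota> r ` (carX E \<union> carY E)"
    by (auto simp: quot_carrier_def \<iota>_def quotient_def)
  show ?thesis
    unfolding partial_order_on_def preorder_on_def carrier
  proof (intro conjI)
    show sub': "quot_le r \<subseteq> \<iota> r ` (carX E \<union> carY E) \<times> \<iota> r ` (carX E \<union> carY E)"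
      using sub by (auto simp: quot_le_def)
    show "refl_on (\<iota> r ` (carX E \<union> carY E)) (quot_le r)"
      using re le by (auto simp: refl_on_def)
    show "trans (quot_le r)"
    proof (rule transI)
      fix A B C assume AB: "(A, B) \<in> quot_le r" and BC: "(B, C) \<in> quot_le r"
      with sub' obtain a b c where abc: "A = \<iota> r a" "B = \<iota> r b" "C = \<iota> r c"
        "a \<in> carX E \<union> carY E" "b \<in> carX E \<union> carY E" "c \<in> carX E \<union> carY E" by blast
      with AB BC le have "(a, b) \<in> r" "(b, c) \<in> r" by auto
      then have "(a, c) \<in> r" using tr by (meson transD)
      then show "(A, C) \<in> quot_le r" using abc le by auto
    qed
    show "antisym (quot_le r)"
    proof (rule antisymI)
      fix A B assume AB: "(A, B) \<in> quot_le r" and BA: "(B, A) \<in> quot_le r"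
      with sub' obtain a b where ab: "A = \<iota> r a" "B = \<iota> r b"
        "a \<in> carX E \<union> carY E" "b \<in> carX E \<union> carY E" by blast
      with AB BA le have "(a, b) \<in> r" "(b, a) \<in> r" by auto
      then show "A = B" using ab iota_eq by auto
    qed
  qed
qed

definition preorder0 :: "('p, 'a) polarity \<Rightarrow> 'a rel \<Rightarrow> bool" where
  "preorder0 E r \<longleftrightarrow>
     preorder_on (carX E \<union> carY E) r \<and>
     (\<forall>x\<in>carX E. \<forall>y\<in>carY E. (x, y) \<in> r \<longleftrightarrow> (x, y) \<in> relR E) \<and>
     leX E \<subseteq> r \<and> leY E \<subseteq> r"

definition preorder1 :: "('p, 'a) polarity \<Rightarrow> 'a rel \<Rightarrow> bool" where
  "preorder1 E r \<longleftrightarrow> preorder0 E r \<and> (\<forall>p\<in>carP E. \<iota> r (eX E p) = \<iota> r (eY E p))"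

definition preorder2 :: "('p, 'a) polarity \<Rightarrow> 'a rel \<Rightarrow> bool" where
  "preorder2 E r \<longleftrightarrow>
     preorder1 E r \<and>
     order_embedding (carX E) (leX E) (quot_carrier E r) (quot_le r) (\<iota> r) \<and>
     order_embedding (carY E) (leY E) (quot_carrier E r) (quot_le r) (\<iota> r)"

definition P4 :: "('p, 'a) polarity \<Rightarrow> 'a rel \<Rightarrow> bool" where
  "P4 E r \<longleftrightarrow> (\<forall>S\<subseteq>carP E. \<forall>m. is_inf (carX E) (leX E) (eX E ` S) m \<longrightarrow>
     is_inf (quot_carrier E r) (quot_le r) ((\<iota> r \<circ> eX E) ` S) (\<iota> r m))"

definition P5 :: "('p, 'a) polarity \<Rightarrow> 'a rel \<Rightarrow> bool" where
  "P5 E r \<longleftrightarrow> (\<forall>T\<subseteq>carP E. \<forall>m. is_sup (carY E) (leY E) (eY E ` T) m \<longrightarrow>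
     is_sup (quot_carrier E r) (quot_le r) ((\<iota> r \<circ> eY E) ` T) (\<iota> r m))"

definition preorder3 :: "('p, 'a) polarity \<Rightarrow> 'a rel \<Rightarrow> bool" where
  "preorder3 E r \<longleftrightarrow> preorder2 E r \<and> P4 E r \<and> P5 E r"

definition Z_S :: "('p, 'a) polarity \<Rightarrow> 'a rel" where
  "Z_S E = {(y, x). y \<in> carY E \<and> x \<in> carX E \<and>
     (\<exists>S\<subseteq>carP E. \<exists>m. is_inf (carX E) (leX E) (eX E ` S) m \<and> (m, x) \<in> leX E \<and>
        (\<forall>p\<in>S. (y, eY E p) \<in> leY E))}"

definition Z_T :: "('p, 'a) polarity \<Rightarrow> 'a rel" where
  "Z_T E = {(y, x). y \<in> carY E \<and> x \<in> carX E \<and>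
     (\<exists>T\<subseteq>carP E. \<exists>m. is_sup (carY E) (leY E) (eY E ` T) m \<and> (y, m) \<in> leY E \<and>
        (\<forall>q\<in>T. (eX E q, x) \<in> leX E))}"

definition le3 :: "('p, 'a) polarity \<Rightarrow> 'a rel" where
  "le3 E = leX E \<union> leY E \<union> relR E \<union> Z_S E \<union> Z_T E"

end

theory Submission
  imports Defs
begin

text \<open>
  Pulled back along the quotient map, a 3-preorder is a preorder on \<open>X \<union> Y\<close> that restricts to
  \<open>\<le>\<^sub>X\<close>, \<open>\<le>\<^sub>Y\<close> and \<open>R\<close>, contains the pairs \<open>(e\<^sub>Y p, e\<^sub>X p)\<close>, and satisfies two Horn conditions
  replacing (P4) and (P5). In these the only test elements of \<open>X \<union> Y\<close> that matter for a meet in \<open>X\<close>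
  (join in \<open>Y\<close>) lie in \<open>Y\<close> (in \<open>X\<close>), because \<open>e\<^sub>X p\<close> and \<open>e\<^sub>Y p\<close> are identified.
  In this form closure under intersections is evident, transitivity forces \<open>Z\<^sub>S\<close> and \<open>Z\<^sub>T\<close> into
  every 3-preorder, and (C1)--(C8) amount to transitivity of \<open>\<preceq>\<^sub>3\<close>.
\<close>

section \<open>Order, meets and joins in the quotient by a preorder\<close>

lemma quot_carrier_eq: "quot_carrier E r = \<iota> r ` (carX E \<union> carY E)"
  by (auto simp: quot_carrier_def \<iota>_def quotient_def)

lemma iota_eq_iff:
  assumes "preorder_on A r" "a \<in> A" "b \<in> A"
  shows "\<iota> r a = \<iota> r b \<longleftrightarrow> (a, b) \<in> r \<and> (b, a) \<in> r"
proof -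
  have "refl_on A r" "trans r"
    using assms(1) by (auto simp: preorder_on_def)
  then show ?thesis
    using assms(2,3) by (fastforce simp: \<iota>_def sym_part_def refl_on_def set_eq_iff dest: transD)
qed

text \<open>\<open>quot_le\<close> only asks for some related representatives \<open>c\<close>,
  \<open>d\<close>. The choice does not matter, since \<open>a\<close>, \<open>c\<close>,
  \<open>d\<close>, \<open>b\<close> form a chain in \<open>r\<close>.\<close>

lemma quot_le_iff:
  assumes "preorder_on A r" "a \<in> A" "b \<in> A"
  shows "(\<iota> r a, \<iota> r b) \<in> quot_le r \<longleftrightarrow> (a, b) \<in> r"
proof
  assume "(\<iota> r a, \<iota> r b) \<in> quot_le r"
  then obtain c d where cd: "(c, d) \<in> r" "\<iota> r a = \<iota> r c" "\<iota> r b = \<iota> r d"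
    by (auto simp: quot_le_def)
  moreover have "c \<in> A" "d \<in> A" and "trans r"
    using cd(1) assms(1) by (auto simp: preorder_on_def)
  ultimately show "(a, b) \<in> r"
    using iota_eq_iff[OF assms(1)] assms(2,3) by (meson transD)
qed (auto simp: quot_le_def)

text \<open>The map \<open>\<iota> r\<close> is onto the quotient and both preserves and reflects
  the order, so bounds can be tested on representatives.\<close>

lemma is_inf_quot_iff:
  assumes "preorder_on (carX E \<union> carY E) r" "f ` S \<subseteq> carX E \<union> carY E" "m \<in> carX E \<union> carY E"
  shows "is_inf (quot_carrier E r) (quot_le r) ((\<iota> r \<circ> f) ` S) (\<iota> r m) \<longleftrightarrow>
    is_inf (carX E \<union> carY E) r (f ` S) m"
proof -
  have le: "(\<iota> r a, \<iota> r (f p)) \<in> quot_le r \<longleftrightarrow> (a, f p) \<in> r"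
    if "a \<in> carX E \<union> carY E" "p \<in> S" for a p
    using that assms(2) by (intro quot_le_iff[OF assms(1)]) auto
  show ?thesis
    using assms(3) le quot_le_iff[OF assms(1) _ assms(3)]
    unfolding is_inf_def quot_carrier_eq ball_simps o_def
    by auto
qed

lemma is_sup_quot_iff:
  assumes "preorder_on (carX E \<union> carY E) r" "f ` S \<subseteq> carX E \<union> carY E" "m \<in> carX E \<union> carY E"
  shows "is_sup (quot_carrier E r) (quot_le r) ((\<iota> r \<circ> f) ` S) (\<iota> r m) \<longleftrightarrow>
    is_sup (carX E \<union> carY E) r (f ` S) m"
proof -
  have le: "(\<iota> r (f p), \<iota> r a) \<in> quot_le r \<longleftrightarrow> (f p, a) \<in> r"
    if "a \<in> carX E \<union> carY E" "p \<in> S" for a p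
    using that assms(2) by (intro quot_le_iff[OF assms(1)]) auto
  show ?thesis
    using assms(3) le quot_le_iff[OF assms(1) assms(3)]
    unfolding is_sup_def quot_carrier_eq ball_simps o_def
    by auto
qed

section \<open>Extension polarities and the quotient-free form of 3-preorders\<close>

locale ext_polarity =
  fixes E :: "('p, 'a) polarity"
  assumes ext: "extension_polarity E"
begin

abbreviation "P \<equiv> carP E"
abbreviation "X \<equiv> carX E"
abbreviation "Y \<equiv> carY E"

lemma disjoint: "x \<in> X \<Longrightarrow> x \<notin> Y"
  using ext by (auto simp: extension_polarity_def)

lemma carriers:
  "(a, b) \<in> leX E \<Longrightarrow> a \<in> X \<and> b \<in> X"
  "(a, b) \<in> leY E \<Longrightarrow> a \<in> Y \<and> b \<in> Y"
  "(a, b) \<in> relR E \<Longrightarrow> a \<in> X \<and> b \<in> Y"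
  using ext by (auto simp: extension_polarity_def partial_order_on_def preorder_on_def)

lemma refl_X: "x \<in> X \<Longrightarrow> (x, x) \<in> leX E"
  and refl_Y: "y \<in> Y \<Longrightarrow> (y, y) \<in> leY E"
  using ext by (auto simp: extension_polarity_def partial_order_on_def preorder_on_def refl_on_def)

lemma trans_X: "trans (leX E)"
  and trans_Y: "trans (leY E)"
  using ext by (auto simp: extension_polarity_def partial_order_on_def preorder_on_def)

lemma eX_in: "p \<in> P \<Longrightarrow> eX E p \<in> X"
  and eY_in: "p \<in> P \<Longrightarrow> eY E p \<in> Y"
  using ext by (auto simp: extension_polarity_def order_embedding_def)

text \<open>Quotient-free form of \<open>preorder2\<close>. Only the pairs from \<open>Y\<close> to
  \<open>X\<close> are left open, so two such relations can differ nowhere else.\<close>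

definition gluing :: "'a rel \<Rightarrow> bool" where
  "gluing r \<longleftrightarrow> preorder_on (X \<union> Y) r \<and>
     (\<forall>x\<in>X. \<forall>y\<in>Y. (x, y) \<in> r \<longleftrightarrow> (x, y) \<in> relR E) \<and>
     (\<forall>x1\<in>X. \<forall>x2\<in>X. (x1, x2) \<in> r \<longleftrightarrow> (x1, x2) \<in> leX E) \<and>
     (\<forall>y1\<in>Y. \<forall>y2\<in>Y. (y1, y2) \<in> r \<longleftrightarrow> (y1, y2) \<in> leY E) \<and>
     (\<forall>p\<in>P. (eX E p, eY E p) \<in> relR E \<and> (eY E p, eX E p) \<in> r)"

text \<open>Form of \<open>P4\<close> for a gluing \<open>r\<close>. Here \<open>r\<close> occurs
  only in the conclusion, so the condition passes to larger relations as well as to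
  intersections.\<close>

definition inf_compatible :: "'a rel \<Rightarrow> bool" where
  "inf_compatible r \<longleftrightarrow> (\<forall>S\<subseteq>P. \<forall>m. is_inf X (leX E) (eX E ` S) m \<longrightarrow>
     (\<forall>y\<in>Y. (\<forall>p\<in>S. (y, eY E p) \<in> leY E) \<longrightarrow> (y, m) \<in> r))"

definition sup_compatible :: "'a rel \<Rightarrow> bool" where
  "sup_compatible r \<longleftrightarrow> (\<forall>T\<subseteq>P. \<forall>m. is_sup Y (leY E) (eY E ` T) m \<longrightarrow>
     (\<forall>x\<in>X. (\<forall>q\<in>T. (eX E q, x) \<in> leX E) \<longrightarrow> (m, x) \<in> r))"

lemma gluing_transD: "gluing r \<Longrightarrow> (a, b) \<in> r \<Longrightarrow> (b, c) \<in> r \<Longrightarrow> (a, c) \<in> r"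
  by (auto simp: gluing_def preorder_on_def dest: transD)

lemma gluing_XX: "gluing r \<Longrightarrow> x1 \<in> X \<Longrightarrow> x2 \<in> X \<Longrightarrow> (x1, x2) \<in> r \<longleftrightarrow> (x1, x2) \<in> leX E"
  and gluing_YY: "gluing r \<Longrightarrow> y1 \<in> Y \<Longrightarrow> y2 \<in> Y \<Longrightarrow> (y1, y2) \<in> r \<longleftrightarrow> (y1, y2) \<in> leY E"
  and gluing_XY: "gluing r \<Longrightarrow> x \<in> X \<Longrightarrow> y \<in> Y \<Longrightarrow> (x, y) \<in> r \<longleftrightarrow> (x, y) \<in> relR E"
  by (auto simp: gluing_def)

lemma gluing_e:
  assumes "gluing r" "p \<in> P"
  shows "(eX E p, eY E p) \<in> r" "(eY E p, eX E p) \<in> r"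
  using assms eX_in eY_in by (auto simp: gluing_def)

lemma preorder2_iff: "preorder2 E r \<longleftrightarrow> gluing r"
proof (cases "preorder_on (X \<union> Y) r")
  case True
  have "order_embedding X (leX E) (quot_carrier E r) (quot_le r) (\<iota> r) \<longleftrightarrow>
      (\<forall>a\<in>X. \<forall>b\<in>X. (a, b) \<in> r \<longleftrightarrow> (a, b) \<in> leX E)"
    using quot_le_iff[OF True] by (auto simp: order_embedding_def quot_carrier_eq)
  moreover have "order_embedding Y (leY E) (quot_carrier E r) (quot_le r) (\<iota> r) \<longleftrightarrow>
      (\<forall>a\<in>Y. \<forall>b\<in>Y. (a, b) \<in> r \<longleftrightarrow> (a, b) \<in> leY E)"
    using quot_le_iff[OF True] by (auto simp: order_embedding_def quot_carrier_eq)
  moreover have "\<iota> r (eX E p) = \<iota> r (eY E p) \<longleftrightarrow> (eX E p, eY E p) \<in> r \<and> (eY E p, eX E p) \<in> r"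
    if "p \<in> P" for p
    using iota_eq_iff[OF True] eX_in[OF that] eY_in[OF that] by auto
  \<comment> \<open>\<open>gluing\<close> has no clause for the two inclusions demanded by
    \<open>preorder0\<close>; they follow from the agreement on \<open>X\<close> and on
    \<open>Y\<close>.\<close>
  moreover have "leX E \<subseteq> r" if "\<forall>a\<in>X. \<forall>b\<in>X. (a, b) \<in> r \<longleftrightarrow> (a, b) \<in> leX E"
    using that carriers(1) by auto
  moreover have "leY E \<subseteq> r" if "\<forall>a\<in>Y. \<forall>b\<in>Y. (a, b) \<in> r \<longleftrightarrow> (a, b) \<in> leY E"
    using that carriers(2) by auto
  ultimately show ?thesis
    unfolding preorder2_def preorder1_def preorder0_def gluing_def
    using True eX_in eY_in by (smt (verit))
qed (auto simp: preorder2_def preorder1_def preorder0_def gluing_def)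

lemma P4_iff:
  assumes r: "gluing r"
  shows "P4 E r \<longleftrightarrow> inf_compatible r"
proof -
  have "is_inf (quot_carrier E r) (quot_le r) ((\<iota> r \<circ> eX E) ` S) (\<iota> r m) \<longleftrightarrow>
      (\<forall>y\<in>Y. (\<forall>p\<in>S. (y, eY E p) \<in> leY E) \<longrightarrow> (y, m) \<in> r)"
    if S: "S \<subseteq> P" and m: "is_inf X (leX E) (eX E ` S) m" for S m
  proof -
    have pre: "preorder_on (X \<union> Y) r" and mX: "m \<in> X"
      using r m by (auto simp: gluing_def is_inf_def)
    have SX: "eX E ` S \<subseteq> X"
      using S eX_in by auto
    have "is_inf (quot_carrier E r) (quot_le r) ((\<iota> r \<circ> eX E) ` S) (\<iota> r m) \<longleftrightarrow>
        is_inf (X \<union> Y) r (eX E ` S) m"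
      using SX mX by (intro is_inf_quot_iff[OF pre]) auto
    \<comment> \<open>On \<open>X\<close> the relation \<open>r\<close> is \<open>leX E\<close>, so
      \<open>m\<close> is already a lower bound and lies above every lower bound from
      \<open>X\<close>. Only test elements in \<open>Y\<close> remain.\<close>
    also have "\<dots> \<longleftrightarrow> (\<forall>y\<in>Y. (\<forall>p\<in>S. (y, eX E p) \<in> r) \<longrightarrow> (y, m) \<in> r)"
    proof -
      have "(z, eX E p) \<in> r \<longleftrightarrow> (z, eX E p) \<in> leX E" if "z \<in> X" "p \<in> S" for z p
        using gluing_XX[OF r] SX that by auto
      then show ?thesis
        using m mX gluing_XX[OF r _ mX] by (auto simp: is_inf_def)
    qed
    \<comment> \<open>\<open>eX E p\<close> and \<open>eY E p\<close> lie below each other in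
      \<open>r\<close>, so being below one is being below the other.\<close>
    also have "\<dots> \<longleftrightarrow> (\<forall>y\<in>Y. (\<forall>p\<in>S. (y, eY E p) \<in> leY E) \<longrightarrow> (y, m) \<in> r)"
    proof -
      have "(y, eX E p) \<in> r \<longleftrightarrow> (y, eY E p) \<in> leY E" if "y \<in> Y" "p \<in> S" for y p
        using gluing_e[OF r] gluing_transD[OF r] gluing_YY[OF r] eY_in S that by (meson subsetD)
      then show ?thesis by auto
    qed
    finally show ?thesis .
  qed
  \<comment> \<open>The equivalence holds only under the premises on \<open>S\<close> and
    \<open>m\<close>; \<open>imp_cong\<close> lets the simplifier assume them while
    rewriting.\<close>
  then show ?thesis
    by (simp add: P4_def inf_compatible_def cong: imp_cong)
qed

lemma P5_iff:
  assumes r: "gluing r"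
  shows "P5 E r \<longleftrightarrow> sup_compatible r"
proof -
  have "is_sup (quot_carrier E r) (quot_le r) ((\<iota> r \<circ> eY E) ` T) (\<iota> r m) \<longleftrightarrow>
      (\<forall>x\<in>X. (\<forall>q\<in>T. (eX E q, x) \<in> leX E) \<longrightarrow> (m, x) \<in> r)"
    if T: "T \<subseteq> P" and m: "is_sup Y (leY E) (eY E ` T) m" for T m
  proof -
    have pre: "preorder_on (X \<union> Y) r" and mY: "m \<in> Y"
      using r m by (auto simp: gluing_def is_sup_def)
    have TY: "eY E ` T \<subseteq> Y"
      using T eY_in by auto
    have "is_sup (quot_carrier E r) (quot_le r) ((\<iota> r \<circ> eY E) ` T) (\<iota> r m) \<longleftrightarrow>
        is_sup (X \<union> Y) r (eY E ` T) m"
      using TY mY by (intro is_sup_quot_iff[OF pre]) auto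
    also have "\<dots> \<longleftrightarrow> (\<forall>x\<in>X. (\<forall>q\<in>T. (eY E q, x) \<in> r) \<longrightarrow> (m, x) \<in> r)"
    proof -
      have "(eY E q, z) \<in> r \<longleftrightarrow> (eY E q, z) \<in> leY E" if "z \<in> Y" "q \<in> T" for z q
        using gluing_YY[OF r] TY that by auto
      then show ?thesis
        using m mY gluing_YY[OF r mY] by (auto simp: is_sup_def)
    qed
    also have "\<dots> \<longleftrightarrow> (\<forall>x\<in>X. (\<forall>q\<in>T. (eX E q, x) \<in> leX E) \<longrightarrow> (m, x) \<in> r)"
    proof -
      have "(eY E q, x) \<in> r \<longleftrightarrow> (eX E q, x) \<in> leX E" if "x \<in> X" "q \<in> T" for x q
        using gluing_e[OF r] gluing_transD[OF r] gluing_XX[OF r] eX_in T that by (meson subsetD)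
      then show ?thesis by auto
    qed
    finally show ?thesis .
  qed
  then show ?thesis
    by (simp add: P5_def sup_compatible_def cong: imp_cong)
qed

lemma preorder3_iff: "preorder3 E r \<longleftrightarrow> gluing r \<and> inf_compatible r \<and> sup_compatible r"
  using preorder2_iff P4_iff P5_iff by (auto simp: preorder3_def)

section \<open>Closure under intersections and minimality of \<open>le3\<close>\<close>

lemma preorder3_Inter:
  assumes "F \<noteq> {}" "\<And>r. r \<in> F \<Longrightarrow> preorder3 E r"
  shows "preorder3 E (\<Inter>F)"
proof -
  have F: "gluing r" "inf_compatible r" "sup_compatible r" if "r \<in> F" for r
    using assms(2)[OF that] by (auto simp: preorder3_iff)
  have pre: "r \<subseteq> (X \<union> Y) \<times> (X \<union> Y)" "refl_on (X \<union> Y) r" "trans r" if "r \<in> F" for r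
    using F(1)[OF that] by (simp_all add: gluing_def preorder_on_def)
  have "\<Inter>F \<subseteq> (X \<union> Y) \<times> (X \<union> Y)"
    using pre(1) assms(1) by (rule Inter_subset)
  moreover have "refl_on (X \<union> Y) (\<Inter>F)"
    using pre(2) by (simp add: refl_on_def)
  moreover have "trans (\<Inter>F)"
    using pre(3) by (meson InterE InterI transD transI)
  ultimately have "preorder_on (X \<union> Y) (\<Inter>F)"
    by (simp add: preorder_on_def)
  \<comment> \<open>All members agree on the pairs within \<open>X\<close>, within \<open>Y\<close>
    and from \<open>X\<close> to \<open>Y\<close>; since \<open>F\<close> is non-empty, so does
    their intersection.\<close>
  then have "gluing (\<Inter>F)"
    using F(1) assms(1) by (auto simp: gluing_def)
  moreover have "inf_compatible (\<Inter>F)" "sup_compatible (\<Inter>F)"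
    using F(2,3) by (auto simp: inf_compatible_def sup_compatible_def)
  ultimately show ?thesis
    by (simp add: preorder3_iff)
qed

text \<open>For \<open>Z_S\<close> compatibility puts \<open>y\<close> below the meet
  \<open>m\<close>, and \<open>m\<close> is below \<open>x\<close>; for \<open>Z_T\<close>,
  \<open>y\<close> is below the join \<open>m\<close>, which compatibility puts below
  \<open>x\<close>.\<close>

lemma le3_subset:
  assumes "preorder3 E r"
  shows "le3 E \<subseteq> r"
proof -
  have r: "gluing r" "inf_compatible r" "sup_compatible r"
    using assms by (auto simp: preorder3_iff)
  have sub: "leX E \<subseteq> r" "leY E \<subseteq> r" "relR E \<subseteq> r"
    using r(1) carriers by (auto simp: gluing_def)
  moreover have "Z_S E \<subseteq> r"
  proof -
    have "(y, x) \<in> r" if "S \<subseteq> P" "is_inf X (leX E) (eX E ` S) m" "(m, x) \<in> leX E"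
      "y \<in> Y" "\<forall>p\<in>S. (y, eY E p) \<in> leY E" for S m x y
      using that r(2) sub(1) gluing_transD[OF r(1), of y m x]
      unfolding inf_compatible_def by blast
    then show ?thesis
      by (auto simp: Z_S_def)
  qed
  moreover have "Z_T E \<subseteq> r"
  proof -
    have "(y, x) \<in> r" if "T \<subseteq> P" "is_sup Y (leY E) (eY E ` T) m" "(y, m) \<in> leY E"
      "x \<in> X" "\<forall>q\<in>T. (eX E q, x) \<in> leX E" for T m x y
      using that r(3) sub(2) gluing_transD[OF r(1), of y m x]
      unfolding sup_compatible_def by blast
    then show ?thesis
      by (auto simp: Z_T_def)
  qed
  ultimately show ?thesis
    by (auto simp: le3_def)
qed

section \<open>Coherence from the existence of a 3-preorder\<close>

lemma three_coherent_if_preorder3: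
  assumes "preorder3 E r"
  shows "three_coherent E"
proof -
  have r: "gluing r" "inf_compatible r" "sup_compatible r"
    using assms by (auto simp: preorder3_iff)
  note tr = gluing_transD[OF r(1)] and e = gluing_e[OF r(1)]
    and le = gluing_XX[OF r(1)] gluing_YY[OF r(1)] gluing_XY[OF r(1)]
  show ?thesis
    unfolding three_coherent_def
  proof (intro conjI)
    show "C1 E" "C2 E"
      unfolding C1_def C2_def using tr le by meson+
    show "C3 E"
      using r(1) by (auto simp: C3_def gluing_def)
    \<comment> \<open>The pair \<open>(eY E p, eX E p)\<close> of \<open>r\<close> links the two
      premises into one chain, and its endpoints are then read off by \<open>le\<close>.\<close>
    show "C4 E" "C5 E" "C6 E"
      unfolding C4_def C5_def C6_def using tr e le eX_in eY_in by meson+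
    show "C7 E"
      unfolding C7_def
    proof (intro ballI allI impI)
      fix x y1 y2 S
      assume x: "x \<in> X" "y1 \<in> Y" "y2 \<in> Y" "S \<subseteq> P"
        "is_inf X (leX E) (eX E ` S) x \<and> (x, y2) \<in> relR E \<and> (\<forall>p\<in>S. (y1, eY E p) \<in> leY E)"
      \<comment> \<open>This step from \<open>Y\<close> to \<open>X\<close> is what (P4)
        contributes; composing it with \<open>(x, y2)\<close> gives a pair within
        \<open>Y\<close>.\<close>
      then have "(y1, x) \<in> r"
        using r(2) by (auto simp: inf_compatible_def)
      then show "(y1, y2) \<in> leY E"
        using x tr le by meson
    qed
    show "C8 E"
      unfolding C8_def
    proof (intro ballI allI impI)
      fix x1 x2 y T
      assume y: "x1 \<in> X" "x2 \<in> X" "y \<in> Y" "T \<subseteq> P"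
        "is_sup Y (leY E) (eY E ` T) y \<and> (x1, y) \<in> relR E \<and> (\<forall>q\<in>T. (eX E q, x2) \<in> leX E)"
      then have "(y, x2) \<in> r"
        using r(3) by (auto simp: sup_compatible_def)
      then show "(x1, x2) \<in> leX E"
        using y tr le by meson
    qed
  qed
qed

section \<open>Coherence makes \<open>le3\<close> a 3-preorder\<close>

lemma Z_carriers: "(a, b) \<in> Z_S E \<union> Z_T E \<Longrightarrow> a \<in> Y \<and> b \<in> X"
  by (auto simp: Z_S_def Z_T_def)

lemma le3_carriers: "(a, b) \<in> le3 E \<Longrightarrow> a \<in> X \<union> Y \<and> b \<in> X \<union> Y"
  using carriers Z_carriers unfolding le3_def by blast

text \<open>As \<open>X\<close> and \<open>Y\<close> are disjoint, the carriers of the two ends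
  decide which pieces of \<open>le3\<close> can contain a pair.\<close>

lemma le3_iff:
  "x1 \<in> X \<Longrightarrow> x2 \<in> X \<Longrightarrow> (x1, x2) \<in> le3 E \<longleftrightarrow> (x1, x2) \<in> leX E"
  "y1 \<in> Y \<Longrightarrow> y2 \<in> Y \<Longrightarrow> (y1, y2) \<in> le3 E \<longleftrightarrow> (y1, y2) \<in> leY E"
  "x \<in> X \<Longrightarrow> y \<in> Y \<Longrightarrow> (x, y) \<in> le3 E \<longleftrightarrow> (x, y) \<in> relR E"
  "y \<in> Y \<Longrightarrow> x \<in> X \<Longrightarrow> (y, x) \<in> le3 E \<longleftrightarrow> (y, x) \<in> Z_S E \<union> Z_T E"
  using disjoint carriers Z_carriers unfolding le3_def by blast+

text \<open>The same \<open>S\<close> or \<open>T\<close>, with the same \<open>m\<close>, still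
  serves: \<open>x1\<close> enters \<open>Z_S\<close> and \<open>Z_T\<close> only as an upper end in
  \<open>leX E\<close>.\<close>

lemma Z_leX_trans:
  assumes "(y, x1) \<in> Z_S E \<union> Z_T E" and x: "(x1, x2) \<in> leX E"
  shows "(y, x2) \<in> Z_S E \<union> Z_T E"
proof -
  have x2: "x2 \<in> X" and tr: "\<And>z. (z, x1) \<in> leX E \<Longrightarrow> (z, x2) \<in> leX E"
    using carriers(1)[OF x] transD[OF trans_X _ x] by auto
  have "(y, x2) \<in> Z_S E" if "(y, x1) \<in> Z_S E"
    using that x2 tr unfolding Z_S_def by blast
  moreover have "(y, x2) \<in> Z_T E" if "(y, x1) \<in> Z_T E"
    using that x2 tr unfolding Z_T_def by blast
  ultimately show ?thesis
    using assms(1) by blast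
qed

lemma leY_Z_trans:
  assumes y: "(y1, y2) \<in> leY E" and "(y2, x) \<in> Z_S E \<union> Z_T E"
  shows "(y1, x) \<in> Z_S E \<union> Z_T E"
proof -
  have y1: "y1 \<in> Y" and tr: "\<And>z. (y2, z) \<in> leY E \<Longrightarrow> (y1, z) \<in> leY E"
    using carriers(2)[OF y] transD[OF trans_Y y] by auto
  have "(y1, x) \<in> Z_S E" if "(y2, x) \<in> Z_S E"
    using that y1 tr unfolding Z_S_def by blast
  moreover have "(y1, x) \<in> Z_T E" if "(y2, x) \<in> Z_T E"
    using that y1 tr unfolding Z_T_def by blast
  ultimately show ?thesis
    using assms(2) by blast
qed

lemma R_Z_trans:
  assumes coh: "three_coherent E" and R: "(x1, y) \<in> relR E" and Z: "(y, x2) \<in> Z_S E \<union> Z_T E"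
  shows "(x1, x2) \<in> leX E"
  using Z
proof
  assume "(y, x2) \<in> Z_S E"
  then obtain S m where S: "S \<subseteq> P" and m: "is_inf X (leX E) (eX E ` S) m" "(m, x2) \<in> leX E"
    and y: "\<And>p. p \<in> S \<Longrightarrow> (y, eY E p) \<in> leY E"
    by (auto simp: Z_S_def)
  have "(x1, eX E p) \<in> leX E" if "p \<in> S" for p
  proof -
    have "(x1, eY E p) \<in> relR E"
      using coh R y[OF that] carriers unfolding three_coherent_def C2_def by blast
    then show ?thesis
      using coh that S R carriers(3) eX_in refl_X unfolding three_coherent_def C5_def by blast
  qed
  then have "(x1, m) \<in> leX E"
    using m(1) R carriers(3) by (auto simp: is_inf_def)
  then show ?thesis
    using m(2) trans_X by (meson transD)
next
  assume "(y, x2) \<in> Z_T E"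
  then obtain T m where T: "T \<subseteq> P" and m: "is_sup Y (leY E) (eY E ` T) m" "(y, m) \<in> leY E"
    and x2: "x2 \<in> X" "\<forall>q\<in>T. (eX E q, x2) \<in> leX E"
    by (auto simp: Z_T_def)
  have "(x1, m) \<in> relR E"
    using coh R m(2) carriers unfolding three_coherent_def C2_def by blast
  then show ?thesis
    using coh T m(1) x2 carriers(3) unfolding three_coherent_def C8_def by blast
qed

text \<open>Dual to \<open>R_Z_trans\<close>: (C1) with (C7) for \<open>Z_S\<close>, and (C1) with
  (C6) for \<open>Z_T\<close>.\<close>

lemma Z_R_trans:
  assumes coh: "three_coherent E" and Z: "(y1, x) \<in> Z_S E \<union> Z_T E" and R: "(x, y2) \<in> relR E"
  shows "(y1, y2) \<in> leY E"
  using Z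
proof
  assume "(y1, x) \<in> Z_S E"
  then obtain S m where S: "S \<subseteq> P" and m: "is_inf X (leX E) (eX E ` S) m" "(m, x) \<in> leX E"
    and y1: "y1 \<in> Y" "\<forall>p\<in>S. (y1, eY E p) \<in> leY E"
    by (auto simp: Z_S_def)
  have "(m, y2) \<in> relR E"
    using coh R m(2) carriers unfolding three_coherent_def C1_def by blast
  then show ?thesis
    using coh S m(1) y1 carriers(3) unfolding three_coherent_def C7_def by blast
next
  assume "(y1, x) \<in> Z_T E"
  then obtain T m where T: "T \<subseteq> P" and m: "is_sup Y (leY E) (eY E ` T) m" "(y1, m) \<in> leY E"
    and x: "\<And>q. q \<in> T \<Longrightarrow> (eX E q, x) \<in> leX E"
    by (auto simp: Z_T_def)
  have "(eY E q, y2) \<in> leY E" if "q \<in> T" for q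
  proof -
    have "(eX E q, y2) \<in> relR E"
      using coh R x[OF that] carriers unfolding three_coherent_def C1_def by blast
    then show ?thesis
      using coh that T R carriers(3) eY_in refl_Y unfolding three_coherent_def C6_def by blast
  qed
  then have "(m, y2) \<in> leY E"
    using m(1) R carriers(3) by (auto simp: is_sup_def)
  then show ?thesis
    using m(2) trans_Y by (meson transD)
qed

text \<open>The carriers of \<open>a\<close>, \<open>b\<close>, \<open>c\<close> give eight cases:
  two are transitivity within \<open>X\<close> or \<open>Y\<close>, two are (C1) and (C2), and the
  other four are the composition lemmas for \<open>Z_S\<close> and \<open>Z_T\<close>.\<close>

lemma trans_le3:
  assumes coh: "three_coherent E"
  shows "trans (le3 E)"
proof (rule transI)
  fix a b c
  assume ab: "(a, b) \<in> le3 E" and bc: "(b, c) \<in> le3 E"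
  have "(a, c) \<in> relR E" if "(a, b) \<in> leX E" "(b, c) \<in> relR E"
    using coh that carriers unfolding three_coherent_def C1_def by blast
  moreover have "(a, c) \<in> relR E" if "(a, b) \<in> relR E" "(b, c) \<in> leY E"
    using coh that carriers unfolding three_coherent_def C2_def by blast
  moreover have "a \<in> X \<union> Y" "b \<in> X \<union> Y" "c \<in> X \<union> Y"
    using ab bc le3_carriers by auto
  ultimately show "(a, c) \<in> le3 E"
    using ab bc transD[OF trans_X, of a b c] transD[OF trans_Y, of a b c]
      Z_leX_trans[of a b c] leY_Z_trans[of a b c] R_Z_trans[OF coh, of a b c] Z_R_trans[OF coh, of a b c]
    by (elim UnE) (simp_all only: le3_iff)
qed

lemma preorder3_le3:
  assumes coh: "three_coherent E"
  shows "preorder3 E (le3 E)"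
proof -
  have "le3 E \<subseteq> (X \<union> Y) \<times> (X \<union> Y)"
    using le3_carriers by auto
  moreover have "refl_on (X \<union> Y) (le3 E)"
    using refl_X refl_Y by (auto simp: refl_on_def le3_def)
  ultimately have "preorder_on (X \<union> Y) (le3 E)"
    using trans_le3[OF coh] by (simp add: preorder_on_def)
  \<comment> \<open>The singleton \<open>{p}\<close> is the witness: \<open>eX E p\<close> is the
    meet of its own singleton.\<close>
  moreover have "(eY E p, eX E p) \<in> Z_S E" if "p \<in> P" for p
    unfolding Z_S_def is_inf_def using that eX_in eY_in refl_X refl_Y
    by (auto intro!: exI[of _ "{p}"] exI[of _ "eX E p"])
  moreover have "(eX E p, eY E p) \<in> relR E" if "p \<in> P" for p
    using coh that by (auto simp: three_coherent_def C3_def)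
  ultimately have "gluing (le3 E)"
    by (simp add: gluing_def le3_iff eX_in eY_in)
  \<comment> \<open>The given \<open>S\<close> and \<open>m\<close> are themselves the witnesses,
    with \<open>(m, m)\<close> in \<open>leX E\<close>; the property then passes up to
    \<open>le3 E\<close>.\<close>
  moreover have "inf_compatible (Z_S E)"
    unfolding inf_compatible_def Z_S_def using refl_X by (auto simp: is_inf_def)
  then have "inf_compatible (le3 E)"
    by (auto simp: inf_compatible_def le3_def)
  moreover have "sup_compatible (Z_T E)"
    unfolding sup_compatible_def Z_T_def using refl_Y by (auto simp: is_sup_def)
  then have "sup_compatible (le3 E)"
    by (auto simp: sup_compatible_def le3_def)
  ultimately show ?thesis
    by (simp add: preorder3_iff)
qed

end

theorem theorem3p19:
  fixes E :: "('p, 'a) polarity"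
  assumes "extension_polarity E"
  shows "(three_coherent E \<longleftrightarrow> preorder3 E (le3 E)) \<and>
    (preorder3 E (le3 E) \<longleftrightarrow> (\<exists>r. preorder3 E r)) \<and>
    (\<forall>F. F \<noteq> {} \<and> F \<subseteq> {r. preorder3 E r} \<longrightarrow> \<Inter>F \<in> {r. preorder3 E r}) \<and>
    ({r. preorder3 E r} \<noteq> {} \<longrightarrow>
       le3 E \<in> {r. preorder3 E r} \<and> (\<forall>r\<in>{r. preorder3 E r}. le3 E \<subseteq> r))"
proof -
  interpret ext_polarity E
    by unfold_locales (rule assms)
  \<comment> \<open>Stated for arbitrary \<open>r\<close>, this leads from any 3-preorder back to
    coherence, and \<open>preorder3_le3\<close> from there to \<open>le3 E\<close>.\<close>
  have coh: "three_coherent E" if "preorder3 E r" for r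
    using that by (rule three_coherent_if_preorder3)
  show ?thesis
    using coh preorder3_le3 le3_subset
    by (auto intro!: preorder3_Inter)
qed

end
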